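(* Let $\gamma : I \to \mathbb{E}^3$ be a unit speed curve of osculating order $3$ with Bishop frame $\{T, M_1, M_2\}$ and Bishop curvatures $k_1, k_2$. If $\gamma$ is of type weak Bishop $AW(3)$, then for all $s \in I$ the curvature equations $$\left(k_1'' - k_1^3 - k_1 k_2^2\right)\left(k_1^2 + k_2^2\right) = k_1^2\left(k_1'' - k_1^3 - k_1 k_2^2\right) + k_1 k_2\left(k_2'' - k_2^3 - k_1^2 k_2\right)$$ and $$\left(k_2'' - k_2^3 - k_1^2 k_2\right)\left(k_1^2 + k_2^2\right) = k_2^2\left(k_2'' - k_2^3 - k_1^2 k_2\right) + k_1 k_2\left(k_1'' - k_1^3 - k_1 k_2^2\right)$$ hold (all functions evaluated at $s$).
   Context: $I \subset \mathbb{R}$ is an interval, $\mathbb{E}^3$ is Euclidean 3-space with inner product $\langle\cdot,\cdot\rangle$ and norm $\|\cdot\|$, curves are smooth, and primes denote derivatives with respect to the arc length parameter $s$. A unit speed curve satisfies $\|\gamma'(s)\| = 1$. It is of (osculating) order $3$ if $\gamma'(s), \gamma''(s), \gamma'''(s)$ are linearly independent for all $s$. A Bishop frame (parallel transport frame) along $\gamma$ is an orthonormal frame $\{T, M_1, M_2\}$ with $T = \gamma'$ satisfying $$T' = k_1 M_1 + k_2 M_2, \qquad M_1' = -k_1 T, \qquad M_2' = -k_2 T,$$ where the functions $k_1, k_2$ are called the first and second Bishop curvatures. Write $$\overline{N}_1 = k_1 M_1 + k_2 M_2, \qquad \overline{N}_3 = \left(k_1'' - k_1^3 - k_1 k_2^2\right)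 M_1 + \left(k_2'' - k_2^3 - k_1^2 k_2\right) M_2, \qquad \overline{N}_1^{\ast} = \frac{\overline{N}_1}{\|\overline{N}_1\|}.$$ The curve is of type weak Bishop $AW(3)$ if $\overline{N}_3(s) = \langle \overline{N}_3(s), \overline{N}_1^{\ast}(s)\rangle\, \overline{N}_1^{\ast}(s)$ for all $s \in I$. *)

theory Defs
  imports "HOL-Analysis.Analysis"
begin

text \<open>Derivatives are taken within the interval, so they are one-sided at an endpoint that
  belongs to it.\<close>

definition nth_deriv_on :: "real set \<Rightarrow> nat \<Rightarrow> (real \<Rightarrow> 'a::real_normed_vector) \<Rightarrow> real \<Rightarrow> 'a" where
  "nth_deriv_on I n f = ((\<lambda>g s. vector_derivative g (at s within I)) ^^ n) f"

definition smooth_on :: "real set \<Rightarrow> (real \<Rightarrow> 'a::real_normed_vector) \<Rightarrow> bool" where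
  "smooth_on I f \<longleftrightarrow> (\<forall>n. \<forall>s\<in>I. nth_deriv_on I n f differentiable (at s within I))"

definition unit_speed_curve :: "real set \<Rightarrow> (real \<Rightarrow> real ^ 3) \<Rightarrow> bool" where
  "unit_speed_curve I \<gamma> \<longleftrightarrow> smooth_on I \<gamma> \<and> (\<forall>s\<in>I. norm (nth_deriv_on I 1 \<gamma> s) = 1)"

text \<open>Since \<open>independent\<close> is a predicate on sets, distinctness is needed to express linear
  independence of the family of the three derivatives.\<close>

definition osculating_order_3 :: "real set \<Rightarrow> (real \<Rightarrow> real ^ 3) \<Rightarrow> bool" where
  "osculating_order_3 I \<gamma> \<longleftrightarrow>
     (\<forall>s\<in>I. distinct [nth_deriv_on I 1 \<gamma> s, nth_deriv_on I 2 \<gamma> s, nth_deriv_on I 3 \<gamma> s] \<and>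
            independent {nth_deriv_on I 1 \<gamma> s, nth_deriv_on I 2 \<gamma> s, nth_deriv_on I 3 \<gamma> s})"

text \<open>The curvatures need no separate smoothness condition: the frame equations give
  \<open>k1 = T' \<bullet> M1\<close> and \<open>k2 = T' \<bullet> M2\<close> on \<open>I\<close>, which are smooth there.\<close>

definition bishop_frame ::
  "real set \<Rightarrow> (real \<Rightarrow> real ^ 3) \<Rightarrow> (real \<Rightarrow> real ^ 3) \<Rightarrow> (real \<Rightarrow> real ^ 3) \<Rightarrow> (real \<Rightarrow> real ^ 3) \<Rightarrow>
   (real \<Rightarrow> real) \<Rightarrow> (real \<Rightarrow> real) \<Rightarrow> bool" where
  "bishop_frame I \<gamma> T M1 M2 k1 k2 \<longleftrightarrow>
     smooth_on I T \<and> smooth_on I M1 \<and> smooth_on I M2 \<and>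
     (\<forall>s\<in>I.
        T s = nth_deriv_on I 1 \<gamma> s \<and>
        norm (T s) = 1 \<and> norm (M1 s) = 1 \<and> norm (M2 s) = 1 \<and>
        T s \<bullet> M1 s = 0 \<and> T s \<bullet> M2 s = 0 \<and> M1 s \<bullet> M2 s = 0 \<and>
        (T has_vector_derivative (k1 s *\<^sub>R M1 s + k2 s *\<^sub>R M2 s)) (at s within I) \<and>
        (M1 has_vector_derivative (- k1 s *\<^sub>R T s)) (at s within I) \<and>
        (M2 has_vector_derivative (- k2 s *\<^sub>R T s)) (at s within I))"

definition N1_bar ::
  "(real \<Rightarrow> real ^ 3) \<Rightarrow> (real \<Rightarrow> real ^ 3) \<Rightarrow> (real \<Rightarrow> real) \<Rightarrow> (real \<Rightarrow> real) \<Rightarrow> real \<Rightarrow> real ^ 3" where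
  "N1_bar M1 M2 k1 k2 s = k1 s *\<^sub>R M1 s + k2 s *\<^sub>R M2 s"

definition N3_bar ::
  "real set \<Rightarrow> (real \<Rightarrow> real ^ 3) \<Rightarrow> (real \<Rightarrow> real ^ 3) \<Rightarrow> (real \<Rightarrow> real) \<Rightarrow> (real \<Rightarrow> real) \<Rightarrow>
   real \<Rightarrow> real ^ 3" where
  "N3_bar I M1 M2 k1 k2 s =
     (nth_deriv_on I 2 k1 s - k1 s ^ 3 - k1 s * k2 s ^ 2) *\<^sub>R M1 s +
     (nth_deriv_on I 2 k2 s - k2 s ^ 3 - k1 s ^ 2 * k2 s) *\<^sub>R M2 s"

text \<open>Along a curve of osculating order 3 the vector \<open>N1_bar\<close> is the nonzero second derivative,
  so the division below is genuine.\<close>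

definition N1_bar_star ::
  "(real \<Rightarrow> real ^ 3) \<Rightarrow> (real \<Rightarrow> real ^ 3) \<Rightarrow> (real \<Rightarrow> real) \<Rightarrow> (real \<Rightarrow> real) \<Rightarrow> real \<Rightarrow> real ^ 3" where
  "N1_bar_star M1 M2 k1 k2 s = N1_bar M1 M2 k1 k2 s /\<^sub>R norm (N1_bar M1 M2 k1 k2 s)"

definition weak_bishop_AW3 ::
  "real set \<Rightarrow> (real \<Rightarrow> real ^ 3) \<Rightarrow> (real \<Rightarrow> real ^ 3) \<Rightarrow> (real \<Rightarrow> real) \<Rightarrow> (real \<Rightarrow> real) \<Rightarrow> bool" where
  "weak_bishop_AW3 I M1 M2 k1 k2 \<longleftrightarrow>
     (\<forall>s\<in>I. N3_bar I M1 M2 k1 k2 s =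
       (N3_bar I M1 M2 k1 k2 s \<bullet> N1_bar_star M1 M2 k1 k2 s) *\<^sub>R N1_bar_star M1 M2 k1 k2 s)"

end

theory Submission
  imports Defs
begin

text \<open>The condition of type weak Bishop \<open>AW(3)\<close> says that \<open>N3_bar\<close> is its own projection onto the
  line spanned by \<open>N1_bar\<close>, so \<open>N3_bar\<close> is a scalar multiple \<open>c\<close> of \<open>N1_bar\<close>. Comparing
  coordinates with respect to the orthonormal pair \<open>M1\<close>, \<open>M2\<close> turns this into \<open>A = c * k1\<close> and
  \<open>B = c * k2\<close>, where \<open>A\<close> and \<open>B\<close> are the two coordinates of \<open>N3_bar\<close>. Hence
  \<open>A * k2 = B * k1\<close>, and each curvature equation is this relation multiplied by one of the
  curvatures, with a common term added to both sides.\<close>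

lemma orthonormal_pair_coordinates_eq:
  fixes u v :: "'a::real_inner"
  assumes "norm u = 1" and "norm v = 1" and "u \<bullet> v = 0"
    and eq: "a *\<^sub>R u + b *\<^sub>R v = p *\<^sub>R u + q *\<^sub>R v"
  shows "a = p" and "b = q"
proof -
  have "u \<bullet> u = 1" "v \<bullet> v = 1" "v \<bullet> u = 0"
    using assms(1-3) by (simp_all add: dot_square_norm inner_commute)
  with \<open>u \<bullet> v = 0\<close> arg_cong[OF eq, of "\<lambda>x. x \<bullet> u"] arg_cong[OF eq, of "\<lambda>x. x \<bullet> v"]
  show "a = p" and "b = q"
    by (simp_all add: inner_add_left)
qed

theorem proposition4p6:
  fixes I :: "real set"
    and \<gamma> T M1 M2 :: "real \<Rightarrow> real ^ 3"
    and k1 k2 :: "real \<Rightarrow> real"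
  assumes "is_interval I" and "interior I \<noteq> {}"
    and "unit_speed_curve I \<gamma>"
    and "osculating_order_3 I \<gamma>"
    and "bishop_frame I \<gamma> T M1 M2 k1 k2"
    and "weak_bishop_AW3 I M1 M2 k1 k2"
  shows "\<forall>s\<in>I.
    (nth_deriv_on I 2 k1 s - k1 s ^ 3 - k1 s * k2 s ^ 2) * (k1 s ^ 2 + k2 s ^ 2) =
      k1 s ^ 2 * (nth_deriv_on I 2 k1 s - k1 s ^ 3 - k1 s * k2 s ^ 2) +
      k1 s * k2 s * (nth_deriv_on I 2 k2 s - k2 s ^ 3 - k1 s ^ 2 * k2 s) \<and>
    (nth_deriv_on I 2 k2 s - k2 s ^ 3 - k1 s ^ 2 * k2 s) * (k1 s ^ 2 + k2 s ^ 2) =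
      k2 s ^ 2 * (nth_deriv_on I 2 k2 s - k2 s ^ 3 - k1 s ^ 2 * k2 s) +
      k1 s * k2 s * (nth_deriv_on I 2 k1 s - k1 s ^ 3 - k1 s * k2 s ^ 2)"
proof
  fix s
  assume s: "s \<in> I"
  define A where "A = nth_deriv_on I 2 k1 s - k1 s ^ 3 - k1 s * k2 s ^ 2"
  define B where "B = nth_deriv_on I 2 k2 s - k2 s ^ 3 - k1 s ^ 2 * k2 s"
  have ortho: "norm (M1 s) = 1" "norm (M2 s) = 1" "M1 s \<bullet> M2 s = 0"
    using assms(5) s by (auto simp: bishop_frame_def)
  \<comment> \<open>The normalising factor of \<open>N1_bar_star\<close> is absorbed into the scalar.\<close>
  define n where "n = norm (N1_bar M1 M2 k1 k2 s)"
  define c where "c = N3_bar I M1 M2 k1 k2 s \<bullet> N1_bar_star M1 M2 k1 k2 s / n"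
  have "N3_bar I M1 M2 k1 k2 s =
      (N3_bar I M1 M2 k1 k2 s \<bullet> N1_bar_star M1 M2 k1 k2 s) *\<^sub>R N1_bar_star M1 M2 k1 k2 s"
    using assms(6) s unfolding weak_bishop_AW3_def by blast
  also have "\<dots> = c *\<^sub>R N1_bar M1 M2 k1 k2 s"
    unfolding c_def n_def by (subst (2) N1_bar_star_def) (simp only: scaleR_scaleR divide_inverse)
  finally have "N3_bar I M1 M2 k1 k2 s = c *\<^sub>R N1_bar M1 M2 k1 k2 s" .
  then have "A *\<^sub>R M1 s + B *\<^sub>R M2 s = (c * k1 s) *\<^sub>R M1 s + (c * k2 s) *\<^sub>R M2 s"
    by (simp add: N3_bar_def N1_bar_def A_def B_def scaleR_add_right)
  from orthonormal_pair_coordinates_eq[OF ortho this]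
  have "A = c * k1 s" "B = c * k2 s" .
  then have "A * (k1 s ^ 2 + k2 s ^ 2) = k1 s ^ 2 * A + k1 s * k2 s * B \<and>
      B * (k1 s ^ 2 + k2 s ^ 2) = k2 s ^ 2 * B + k1 s * k2 s * A"
    by (simp add: algebra_simps power2_eq_square)
  then show "(nth_deriv_on I 2 k1 s - k1 s ^ 3 - k1 s * k2 s ^ 2) * (k1 s ^ 2 + k2 s ^ 2) =
      k1 s ^ 2 * (nth_deriv_on I 2 k1 s - k1 s ^ 3 - k1 s * k2 s ^ 2) +
      k1 s * k2 s * (nth_deriv_on I 2 k2 s - k2 s ^ 3 - k1 s ^ 2 * k2 s) \<and>
    (nth_deriv_on I 2 k2 s - k2 s ^ 3 - k1 s ^ 2 * k2 s) * (k1 s ^ 2 + k2 s ^ 2) =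
      k2 s ^ 2 * (nth_deriv_on I 2 k2 s - k2 s ^ 3 - k1 s ^ 2 * k2 s) +
      k1 s * k2 s * (nth_deriv_on I 2 k1 s - k1 s ^ 3 - k1 s * k2 s ^ 2)"
    unfolding A_def B_def .
qed

end
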